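(* Let $X_i=f(\theta,z_i)+\varepsilon_i$, $i=1,\dots,n$, be the regression model described in the context, with $\theta\in\Theta=(a,b)$. Let $z_i\in[c,d]$ for all $i$, $z_{n:n}\to d$ ($d=\infty$ is allowed), $\max_{i\le n}\Delta z_{ni}\to0$. Suppose $f(\theta,z)$ is Riemann integrable in the second argument on $[c,d]$, the function $T(t)=\int_c^df(t,z)\,dz$ is strictly monotone and continuous on $(a,b)$, and the inverse function $T^{-1}$ satisfies a Hölder condition with exponent $p\in(0,1]$. (1) Suppose also that, for a numerical sequence $\alpha_n$, $$\alpha_n^{1/p}d_n\to0,\quad\text{where } d_n^2=\sum_{i=1}^n(\Delta z_{ni})^2\,\mathbf{E}\varepsilon_{ni}^2,$$ $$\alpha_n^{1/p}\sum_{i=1}^n\omega_{f,\theta}(\Delta z_{ni})\Delta z_{ni}\to0,\qquad \alpha_n^{1/p}\int_{z_{n:n}}^df(\theta,z)\,dz\to0.$$ Then the estimator $$\theta_n^*=T^{-1}\Big(\sum_{i=1}^n\Delta z_{ni}X_{ni}\Big)$$ is $\alpha_n$-consistent, i.e. $\alpha_n(\theta_n^*-\theta)\xrightarrow{p}0$. (2) Suppose, in addition to the assumptions preceding (1), that $T$ is continuously differentiable, that (in place of the three conditions displayed in (1)) $$\frac1{d_n}\sum_{i=1}^n\omega_{f,\theta}(\Delta z_{ni})\Delta z_{ni}\to0,\qquad\frac1{d_n}\int_{z_{n:n}}^df(\theta,z)\,dz\to0,$$ and that $d_n\to0$ and $\sum_{i=1}^n\Delta z_{ni}\varepsilon_{ni}/d_n\Rightarrow\mathcal{N}(0,1)$.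 Then $$(\theta_n^*-\theta)/d_n\Rightarrow\mathcal{N}\big(0,[T'(\theta)]^{-2}\big).$$
   Context: All limits are as $n\to\infty$; $\xrightarrow{p}$ is convergence in probability, $\Rightarrow$ is weak convergence of distributions. Model: the observations are $X_i=f(\theta,z_i)+\varepsilon_i$, $i=1,\dots,n$, where the function $f(\cdot,\cdot)$ and the numerical sequence $(z_i)$ are known, the errors $\varepsilon_i$ are independent with $\mathbf{E}\varepsilon_i=0$, $\mathbf{E}\varepsilon_i^2<\infty$, and $\theta\in\Theta=(a,b)$ is the unknown true parameter value. For each fixed $n$ the numbers $z_1,\dots,z_n$ are arranged in increasing order $z_{n:1}\le\dots\le z_{n:n}$, and the $X_i$, $\varepsilon_i$ are renumbered correspondingly, so that $X_{ni}=f(\theta,z_{n:i})+\varepsilon_{ni}$, $\mathbf{E}\varepsilon_{ni}=0$, $\mathbf{E}\varepsilon_{ni}^2<\infty$, $i=1,\dots,n$, with $\varepsilon_{n1},\dots,\varepsilon_{nn}$ independent. Notation: $z_{n:0}=c$, $\Delta z_{ni}=z_{n:i}-z_{n:i-1}$; $\omega_{f,\theta}(\Delta)=\sup_{|t_1-t_2|\le\Delta}|f(\theta,t_1)-f(\theta,t_2)|$. When $d=\infty$, integrals up to $d$ are improper Riemann integrals.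
   Formalization: In (2), T'(θ) ≠ 0 is assumed, since otherwise N(0,[T'(θ)]^{-2}) is undefined (e.g. T(t)=t³ at θ=0); T^{-1}, undefined outside T(Θ), is taken to be any extension that is Borel and bounded off T(Θ); α_n ≥ 0. *)

theory Defs
  imports "HOL-Probability.Probability"
begin

section \<open>Riemann integrals over [c,d], improper when d is infinite\<close>

text \<open>
  The library integral is the gauge integral. A Riemann integral is obtained by restricting the
  gauges to balls of one constant radius, i.e. by controlling only the mesh of the partition.
\<close>

definition has_riemann_integral :: "(real \<Rightarrow> real) \<Rightarrow> real \<Rightarrow> real \<Rightarrow> real \<Rightarrow> bool" where
  "has_riemann_integral g I u v \<longleftrightarrow>
     (\<forall>e>0. \<exists>\<delta>>0. \<forall>\<D>. \<D> tagged_division_of {u..v} \<and> (\<lambda>x. ball x \<delta>) fine \<D> \<longrightarrow>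
        \<bar>(\<Sum>(x, K)\<in>\<D>. measure lborel K * g x) - I\<bar> < e)"

definition riemann_integrable :: "(real \<Rightarrow> real) \<Rightarrow> real \<Rightarrow> real \<Rightarrow> bool" where
  "riemann_integrable g u v \<longleftrightarrow> (\<exists>I. has_riemann_integral g I u v)"

text \<open>
  By the next lemma, the value of a Riemann integral is given by the library's \<open>integral\<close>.
\<close>

lemma has_riemann_integral_imp_has_integral:
  assumes "has_riemann_integral g I u v"
  shows "(g has_integral I) {u..v}"
  unfolding has_integral_real
proof (intro allI impI)
  fix e :: real
  assume "e > 0"
  then obtain \<delta> where "\<delta> > 0" and \<delta>: "\<forall>\<D>. \<D> tagged_division_of {u..v} \<and> (\<lambda>x. ball x \<delta>) fine \<D> \<longrightarrow>
        \<bar>(\<Sum>(x, K)\<in>\<D>. measure lborel K * g x) - I\<bar> < e"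
    using assms unfolding has_riemann_integral_def by blast
  have "gauge (\<lambda>x::real. ball x \<delta>)"
    using \<open>\<delta> > 0\<close> by (rule gauge_ball)
  with \<delta> show "\<exists>\<gamma>. gauge \<gamma> \<and> (\<forall>\<D>. \<D> tagged_division_of {u..v} \<and> \<gamma> fine \<D> \<longrightarrow>
        norm ((\<Sum>(x, K)\<in>\<D>. measure lborel K *\<^sub>R g x) - I) < e)"
    by auto
qed

definition riemann_integrable_upto :: "(real \<Rightarrow> real) \<Rightarrow> real \<Rightarrow> ereal \<Rightarrow> bool" where
  "riemann_integrable_upto g u d \<longleftrightarrow>
     (if d = \<infinity>
      then (\<forall>v\<ge>u. riemann_integrable g u v) \<and> (\<exists>L. ((\<lambda>v. integral {u..v} g) \<longlongrightarrow> L) at_top)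
      else riemann_integrable g u (real_of_ereal d))"

definition riemann_integral_upto :: "(real \<Rightarrow> real) \<Rightarrow> real \<Rightarrow> ereal \<Rightarrow> real" where
  "riemann_integral_upto g u d =
     (if d = \<infinity> then Lim at_top (\<lambda>v. integral {u..v} g) else integral {u..real_of_ereal d} g)"


section \<open>Analytic notions\<close>

text \<open>
  The supremum is taken over points of [c,d] (of [c,\<open>\<infinity>\<close>) when d is infinite). It is
  extended-real-valued, because it need not be finite on an unbounded interval.
\<close>

definition modulus :: "real \<Rightarrow> ereal \<Rightarrow> (real \<Rightarrow> real) \<Rightarrow> real \<Rightarrow> ereal" where
  "modulus c d g \<Delta> =
     (SUP (s, t) \<in> {(s, t). c \<le> s \<and> ereal s \<le> d \<and> c \<le> t \<and> ereal t \<le> d \<and> \<bar>s - t\<bar> \<le> \<Delta>}.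
        ereal \<bar>g s - g t\<bar>)"

definition holder_on :: "real \<Rightarrow> real set \<Rightarrow> (real \<Rightarrow> real) \<Rightarrow> bool" where
  "holder_on p A g \<longleftrightarrow> (\<exists>L. \<forall>x\<in>A. \<forall>y\<in>A. \<bar>g x - g y\<bar> \<le> L * \<bar>x - y\<bar> powr p)"

text \<open>
  The inverse of T is only defined on the image of the parameter set, whereas the random argument
  of the estimator may fall outside of that image. We allow every inverse that is extended to the
  remaining points in a bounded and Borel way, for instance by a constant or by clamping.
\<close>

definition inverse_extension :: "real set \<Rightarrow> (real \<Rightarrow> real) \<Rightarrow> (real \<Rightarrow> real) \<Rightarrow> bool" where
  "inverse_extension \<Theta> T g \<longleftrightarrow>
     (\<forall>t\<in>\<Theta>. g (T t) = t) \<and> g \<in> borel_measurable borel \<and> bounded (g ` (- (T ` \<Theta>)))"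

lemma inverse_extension_inv_into:
  assumes "open \<Theta>" "continuous_on \<Theta> T" "inj_on T \<Theta>"
  shows "inverse_extension \<Theta> T (inv_into \<Theta> T)"
proof -
  have inv: "inv_into \<Theta> T (T t) = t" if "t \<in> \<Theta>" for t
    using assms(3) that by simp
  have cont: "continuous_on (T ` \<Theta>) (inv_into \<Theta> T)"
    by (rule continuous_on_inverse_open) (use assms inv in auto)
  have "open (T ` \<Theta>)"
    using injective_into_1d_imp_open_map_UNIV[OF assms(1,2,3)] by simp
  then have img: "T ` \<Theta> \<in> sets borel"
    by simp
  define k where "k = (SOME y::real. False)"
  have out: "inv_into \<Theta> T x = k" if "x \<notin> T ` \<Theta>" for x
  proof -
    have "(\<lambda>y. y \<in> \<Theta> \<and> T y = x) = (\<lambda>y. False)"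
      using that by auto
    then show ?thesis
      by (simp add: inv_into_def k_def)
  qed
  have "(\<lambda>x. if x \<in> T ` \<Theta> then inv_into \<Theta> T x else k) \<in> borel_measurable borel"
    by (rule borel_measurable_continuous_on_if[OF img cont]) simp
  moreover have "(\<lambda>x. if x \<in> T ` \<Theta> then inv_into \<Theta> T x else k) = inv_into \<Theta> T"
    using out by auto
  moreover have "inv_into \<Theta> T ` (- (T ` \<Theta>)) \<subseteq> {k}"
    using out by auto
  then have "bounded (inv_into \<Theta> T ` (- (T ` \<Theta>)))"
    by (rule bounded_subset[rotated]) simp
  ultimately show ?thesis
    using inv by (simp add: inverse_extension_def)
qed


section \<open>Convergence in probability\<close>

definition tendsto_in_prob :: "'w measure \<Rightarrow> (nat \<Rightarrow> 'w \<Rightarrow> real) \<Rightarrow> real \<Rightarrow> bool" where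
  "tendsto_in_prob M Y y \<longleftrightarrow>
     (\<forall>e>0. (\<lambda>n. measure M {\<omega> \<in> space M. \<bar>Y n \<omega> - y\<bar> > e}) \<longlonglongrightarrow> 0)"


section \<open>Ordered design points and the estimator\<close>

text \<open>
  \<open>\<sigma> n i\<close> is the original index of the observation that becomes the i-th one
  after \<open>z 1, \<dots>, z n\<close> are sorted; ties may be broken arbitrarily.
\<close>

definition sorts_design :: "(nat \<Rightarrow> real) \<Rightarrow> (nat \<Rightarrow> nat \<Rightarrow> nat) \<Rightarrow> bool" where
  "sorts_design z \<sigma> \<longleftrightarrow>
     (\<forall>n. \<sigma> n permutes {1..n} \<and> mono_on {1..n} (\<lambda>i. z (\<sigma> n i)))"

definition zord :: "real \<Rightarrow> (nat \<Rightarrow> real) \<Rightarrow> (nat \<Rightarrow> nat \<Rightarrow> nat) \<Rightarrow> nat \<Rightarrow> nat \<Rightarrow> real" where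
  "zord c z \<sigma> n i = (if i = 0 then c else z (\<sigma> n i))"

definition dz :: "real \<Rightarrow> (nat \<Rightarrow> real) \<Rightarrow> (nat \<Rightarrow> nat \<Rightarrow> nat) \<Rightarrow> nat \<Rightarrow> nat \<Rightarrow> real" where
  "dz c z \<sigma> n i = zord c z \<sigma> n i - zord c z \<sigma> n (i - 1)"

definition modulus_sum ::
    "real \<Rightarrow> ereal \<Rightarrow> (nat \<Rightarrow> real) \<Rightarrow> (nat \<Rightarrow> nat \<Rightarrow> nat) \<Rightarrow> (real \<Rightarrow> real) \<Rightarrow> nat \<Rightarrow> ereal" where
  "modulus_sum c d z \<sigma> g n =
     (\<Sum>i=1..n. modulus c d g (dz c z \<sigma> n i) * ereal (dz c z \<sigma> n i))"

definition noise_scale ::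
    "'w measure \<Rightarrow> real \<Rightarrow> (nat \<Rightarrow> real) \<Rightarrow> (nat \<Rightarrow> nat \<Rightarrow> nat) \<Rightarrow> (nat \<Rightarrow> 'w \<Rightarrow> real) \<Rightarrow> nat \<Rightarrow> real" where
  "noise_scale M c z \<sigma> \<epsilon> n =
     sqrt (\<Sum>i=1..n. (dz c z \<sigma> n i)\<^sup>2 * (\<integral>\<omega>. (\<epsilon> (\<sigma> n i) \<omega>)\<^sup>2 \<partial>M))"

definition weighted_sum ::
    "real \<Rightarrow> (nat \<Rightarrow> real) \<Rightarrow> (nat \<Rightarrow> nat \<Rightarrow> nat) \<Rightarrow> (nat \<Rightarrow> 'w \<Rightarrow> real) \<Rightarrow> nat \<Rightarrow> 'w \<Rightarrow> real" where
  "weighted_sum c z \<sigma> Y n \<omega> = (\<Sum>i=1..n. dz c z \<sigma> n i * Y (\<sigma> n i) \<omega>)"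

definition theta_est ::
    "(real \<Rightarrow> real) \<Rightarrow> real \<Rightarrow> (nat \<Rightarrow> real) \<Rightarrow> (nat \<Rightarrow> nat \<Rightarrow> nat) \<Rightarrow> (nat \<Rightarrow> 'w \<Rightarrow> real) \<Rightarrow> nat \<Rightarrow> 'w \<Rightarrow> real" where
  "theta_est Tinv c z \<sigma> X n \<omega> = Tinv (weighted_sum c z \<sigma> X n \<omega>)"

end

(*
  The weighted sum of the observations equals T(theta) plus noise plus a deterministic bias. The
  noise has second moment d_n^2. The bias is the error of a right-endpoint Riemann sum, at most
  the sum of the moduli of continuity times the mesh widths, and the tail of the integral.
  Part (1) follows from Chebyshev's inequality and the Hoelder bound. Part (2) is the delta
  method: Skorohod's theorem turns the weak convergence of the normalized noise into pointwise
  convergence, where the derivative of the inverse of T at T(theta) can be used.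
*)

theory Submission
  imports Defs
begin

section \<open>Right-endpoint Riemann sums and the modulus of continuity\<close>

lemma modulus_upper:
  assumes "c \<le> s" "ereal s \<le> d" "c \<le> t" "ereal t \<le> d" "\<bar>s - t\<bar> \<le> \<Delta>"
  shows "ereal \<bar>g s - g t\<bar> \<le> modulus c d g \<Delta>"
  unfolding modulus_def using assms by (intro SUP_upper2[where i="(s, t)"]) auto

lemma modulus_nonneg:
  assumes "c \<le> s" "ereal s \<le> d" "0 \<le> \<Delta>"
  shows "0 \<le> modulus c d g \<Delta>"
  using modulus_upper[of c s d s \<Delta> g] assms by (simp add: zero_ereal_def)

text \<open>The error is the integral of \<open>g v - g s\<close> over the cell, and its integrand
  is at most the modulus at the width of the cell. The degenerate cell is separate: there an
  infinite modulus times 0 is 0 in \<open>ereal\<close>, and the left side is 0 too.\<close>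

lemma right_endpoint_error:
  assumes "u \<le> v" "c \<le> u" "ereal v \<le> d" "g integrable_on {u..v}"
  shows "ereal \<bar>(v - u) * g v - integral {u..v} g\<bar> \<le> modulus c d g (v - u) * ereal (v - u)"
proof (cases "u = v")
  case True
  then show ?thesis by (simp flip: zero_ereal_def)
next
  case False
  with assms have uv: "u < v" by simp
  have nonneg: "0 \<le> modulus c d g (v - u)"
    using assms by (intro modulus_nonneg[of _ v]) auto
  show ?thesis
  \<comment> \<open>Only a finite modulus needs an argument: an infinite one times a positive width
    makes the right side infinite, and minus infinity is ruled out by \<open>nonneg\<close>.\<close>
  proof (cases "modulus c d g (v - u)")
    case (real m)
    have le: "\<bar>g v - g s\<bar> \<le> m" if "s \<in> {u..v}" for s
    proof -
      have "ereal s \<le> d"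
        using that assms(3) by (metis atLeastAtMost_iff ereal_less_eq(3) order_trans)
      then have "ereal \<bar>g v - g s\<bar> \<le> modulus c d g (v - u)"
        using that assms by (intro modulus_upper) auto
      then show ?thesis using real by simp
    qed
    have "((\<lambda>s. g v - g s) has_integral (v - u) * g v - integral {u..v} g) {u..v}"
      using has_integral_diff[OF has_integral_const_real[of "g v" u v] integrable_integral[OF assms(4)]]
        assms(1) by simp
    then have "norm ((v - u) * g v - integral {u..v} g) \<le> m * measure lborel {u..v}"
      by (rule has_integral_bound_real[where S="{}", rotated 2]) (use nonneg real le in auto)
    then show ?thesis
      using real uv by simp
  qed (use uv nonneg in auto)
qed

text \<open>The errors of the cells add up by the triangle inequality, one cell per induction step.
  The nodes increase only weakly, so tied design points are covered, and staying in
  \<open>ereal\<close> admits infinite moduli.\<close>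

lemma right_riemann_sum_error:
  fixes x :: "nat \<Rightarrow> real"
  assumes "\<And>i. i < n \<Longrightarrow> x i \<le> x (Suc i)" "c \<le> x 0" "ereal (x n) \<le> d" "g integrable_on {x 0..x n}"
  shows "ereal \<bar>(\<Sum>i=1..n. (x i - x (i - 1)) * g (x i)) - integral {x 0..x n} g\<bar>
    \<le> (\<Sum>i=1..n. modulus c d g (x i - x (i - 1)) * ereal (x i - x (i - 1)))"
  using assms
proof (induction n)
  case 0
  then show ?case by simp
next
  case (Suc n)
  have mono: "x i \<le> x j" if "i \<le> j" "j \<le> Suc n" for i j
    using that(1,2)
  proof (induction j rule: dec_induct)
    case (step k)
    then show ?case using Suc.prems(1)[of k] by simp
  qed simp
  have le: "x 0 \<le> x n" "x n \<le> x (Suc n)"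
    using mono[of 0 n] mono[of n "Suc n"] by auto
  have d: "ereal (x n) \<le> d"
    using le Suc.prems(3) by (metis ereal_less_eq(3) order_trans)
  have int: "g integrable_on {x 0..x n}" "g integrable_on {x n..x (Suc n)}"
    using Suc.prems(4) le by (auto elim!: integrable_subinterval_real)
  have split: "integral {x 0..x (Suc n)} g = integral {x 0..x n} g + integral {x n..x (Suc n)} g"
    using Henstock_Kurzweil_Integration.integral_combine[OF le Suc.prems(4)] by simp
  let ?S = "(\<Sum>i=1..n. (x i - x (i - 1)) * g (x i)) - integral {x 0..x n} g"
  let ?P = "(x (Suc n) - x n) * g (x (Suc n)) - integral {x n..x (Suc n)} g"
  have "ereal \<bar>(\<Sum>i=1..Suc n. (x i - x (i - 1)) * g (x i)) - integral {x 0..x (Suc n)} g\<bar>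
      = ereal \<bar>?S + ?P\<bar>"
    using split by (simp add: algebra_simps)
  also have "\<dots> \<le> ereal \<bar>?S\<bar> + ereal \<bar>?P\<bar>"
    by (simp add: abs_triangle_ineq)
  also have "\<dots> \<le> (\<Sum>i=1..n. modulus c d g (x i - x (i - 1)) * ereal (x i - x (i - 1)))
      + modulus c d g (x (Suc n) - x n) * ereal (x (Suc n) - x n)"
    using Suc.IH Suc.prems d int le right_endpoint_error[of "x n" "x (Suc n)" c d g]
    by (intro add_mono) auto
  finally show ?case by simp
qed

section \<open>Splitting proper and improper integrals at an intermediate point\<close>

lemma riemann_integrable_imp_integrable_on:
  "riemann_integrable g u v \<Longrightarrow> g integrable_on {u..v}"
  unfolding riemann_integrable_def
  using has_riemann_integral_imp_has_integral has_integral_integrable by blast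

lemma riemann_integral_upto_split:
  assumes g: "riemann_integrable_upto g c d" and v: "c \<le> v" "ereal v \<le> d"
  shows "g integrable_on {c..v}"
    and "riemann_integral_upto g c d = integral {c..v} g + riemann_integral_upto g v d"
proof -
  have "g integrable_on {c..v} \<and>
    riemann_integral_upto g c d = integral {c..v} g + riemann_integral_upto g v d"
  proof (cases "d = \<infinity>")
    case True
    then have int: "g integrable_on {c..w}" if "c \<le> w" for w
      using g that by (auto simp: riemann_integrable_upto_def intro: riemann_integrable_imp_integrable_on)
    obtain L where L: "((\<lambda>w. integral {c..w} g) \<longlongrightarrow> L) at_top"
      using g True by (auto simp: riemann_integrable_upto_def)
    have "eventually (\<lambda>w. integral {c..w} g - integral {c..v} g = integral {v..w} g) at_top"
      using eventually_ge_at_top[of v]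
    proof eventually_elim
      case (elim w)
      then show ?case
        using Henstock_Kurzweil_Integration.integral_combine[of c v w g] int[of w] v by auto
    qed
    moreover have "((\<lambda>w. integral {c..w} g - integral {c..v} g) \<longlongrightarrow> L - integral {c..v} g) at_top"
      by (intro tendsto_intros L)
    ultimately have L': "((\<lambda>w. integral {v..w} g) \<longlongrightarrow> L - integral {c..v} g) at_top"
      by (rule Lim_transform_eventually[rotated])
    \<comment> \<open>\<open>Lim\<close> denotes the limit only if there is one, so convergence of
      both truncated integrals has to be established before their values can be compared.\<close>
    have "Lim at_top (\<lambda>w. integral {c..w} g) = L"
      "Lim at_top (\<lambda>w. integral {v..w} g) = L - integral {c..v} g"
      using L L' by (auto intro!: tendsto_Lim)
    then show ?thesis
      using True int v by (simp add: riemann_integral_upto_def)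
  next
    case False
    then obtain d' where d': "d = ereal d'"
      using v by (cases d) auto
    then have int: "g integrable_on {c..d'}"
      using g by (auto simp: riemann_integrable_upto_def intro: riemann_integrable_imp_integrable_on)
    have "g integrable_on {c..v}"
      using int v d' by (auto elim!: integrable_subinterval_real)
    moreover have "integral {c..v} g + integral {v..d'} g = integral {c..d'} g"
      using v d' int by (intro Henstock_Kurzweil_Integration.integral_combine) auto
    ultimately show ?thesis
      using d' by (simp add: riemann_integral_upto_def)
  qed
  then show "g integrable_on {c..v}"
    and "riemann_integral_upto g c d = integral {c..v} g + riemann_integral_upto g v d"
    by auto
qed

section \<open>Sorted nodes and the variance of the noise\<close>

lemma zord_mono:
  assumes design: "\<And>i. i \<ge> 1 \<Longrightarrow> c \<le> z i \<and> ereal (z i) \<le> d"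
    and sorted: "sorts_design z \<sigma>" and n: "i < n"
  shows "zord c z \<sigma> n i \<le> zord c z \<sigma> n (Suc i)"
proof (cases "i = 0")
  case True
  \<comment> \<open>The first node is compared with \<open>c\<close>, not with a design point;
    \<open>design\<close> speaks only of indices from 1 on, so the index \<open>\<sigma> n 1\<close>
    must be shown to be one of them.\<close>
  have "\<sigma> n 1 \<in> {1..n}"
    using sorted n permutes_in_image[of "\<sigma> n" "{1..n}" 1] by (simp add: sorts_design_def)
  then show ?thesis using True design by (simp add: zord_def)
next
  case False
  then show ?thesis
    using sorted n unfolding sorts_design_def zord_def
    by (auto simp: mono_on_def)
qed

text \<open>Expanding the square of \<open>Y i\<close> plus the remaining sum leaves one cross term.
  Its factors are independent and \<open>Y i\<close> is centered, so its expectation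
  vanishes.\<close>

lemma (in prob_space) second_moment_sum_indep:
  fixes Y :: "'i \<Rightarrow> 'a \<Rightarrow> real"
  assumes "finite I" "indep_vars (\<lambda>_. borel) Y I"
    and "\<And>i. i \<in> I \<Longrightarrow> integrable M (Y i)" "\<And>i. i \<in> I \<Longrightarrow> expectation (Y i) = 0"
    and "\<And>i. i \<in> I \<Longrightarrow> integrable M (\<lambda>\<omega>. (Y i \<omega>)\<^sup>2)"
  shows "integrable M (\<lambda>\<omega>. (\<Sum>i\<in>I. Y i \<omega>)\<^sup>2) \<and>
    expectation (\<lambda>\<omega>. (\<Sum>i\<in>I. Y i \<omega>)\<^sup>2) = (\<Sum>i\<in>I. expectation (\<lambda>\<omega>. (Y i \<omega>)\<^sup>2))"
  using assms
proof (induction I rule: finite_induct)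
  case empty
  then show ?case by simp
next
  case (insert i I)
  let ?S = "\<lambda>\<omega>. \<Sum>i\<in>I. Y i \<omega>"
  have ind: "indep_var borel (Y i) borel ?S"
    using insert by (intro indep_vars_sum) auto
  have IH: "integrable M (\<lambda>\<omega>. (?S \<omega>)\<^sup>2)"
    "expectation (\<lambda>\<omega>. (?S \<omega>)\<^sup>2) = (\<Sum>i\<in>I. expectation (\<lambda>\<omega>. (Y i \<omega>)\<^sup>2))"
    using insert.IH insert.prems by (auto intro: indep_vars_subset)
  have S: "integrable M ?S"
    using insert.prems by auto
  have prod: "integrable M (\<lambda>\<omega>. Y i \<omega> * ?S \<omega>)" "expectation (\<lambda>\<omega>. Y i \<omega> * ?S \<omega>) = 0"
    using indep_var_integrable[OF ind _ S] indep_var_lebesgue_integral[OF ind _ S] insert.prems by auto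
  have eq: "(\<lambda>\<omega>. (\<Sum>i\<in>insert i I. Y i \<omega>)\<^sup>2) = (\<lambda>\<omega>. (Y i \<omega>)\<^sup>2 + (2 * (Y i \<omega> * ?S \<omega>) + (?S \<omega>)\<^sup>2))"
    using insert.hyps by (auto simp: power2_sum algebra_simps)
  have Yi: "integrable M (\<lambda>\<omega>. (Y i \<omega>)\<^sup>2)"
    using insert.prems by auto
  show ?case
    unfolding eq using prod IH Yi insert.hyps by simp
qed

text \<open>Independence is given for the errors in their original order, while the weights follow
  the sorted order. Since a finite sum does not depend on the order of its terms, each weight is
  carried back along the inverse permutation before the variances are added.\<close>

lemma weighted_sum_indep_second_moment:
  assumes prob: "prob_space M"
    and indep: "prob_space.indep_vars M (\<lambda>_. borel) \<epsilon> {1..}"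
    and mean: "\<And>i. i \<ge> 1 \<Longrightarrow> integrable M (\<epsilon> i) \<and> (\<integral>\<omega>. \<epsilon> i \<omega> \<partial>M) = 0"
    and var: "\<And>i. i \<ge> 1 \<Longrightarrow> integrable M (\<lambda>\<omega>. (\<epsilon> i \<omega>)\<^sup>2)"
    and sorted: "sorts_design z \<sigma>"
  shows "integrable M (\<lambda>\<omega>. (weighted_sum c z \<sigma> \<epsilon> n \<omega>)\<^sup>2)"
    and "(\<integral>\<omega>. (weighted_sum c z \<sigma> \<epsilon> n \<omega>)\<^sup>2 \<partial>M) = (noise_scale M c z \<sigma> \<epsilon> n)\<^sup>2"
proof -
  interpret prob_space M by fact
  have perm: "\<sigma> n permutes {1..n}"
    using sorted by (simp add: sorts_design_def)
  define w where "w j = dz c z \<sigma> n (inv (\<sigma> n) j)" for j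
  have reindex: "(\<Sum>i=1..n. h (dz c z \<sigma> n i) (\<sigma> n i)) = (\<Sum>j=1..n. h (w j) j)"
    for h :: "real \<Rightarrow> nat \<Rightarrow> real"
    by (subst sum.reindex_bij_betw[OF permutes_imp_bij[OF perm], symmetric])
      (simp add: w_def permutes_inverses[OF perm])
  have ws: "weighted_sum c z \<sigma> \<epsilon> n = (\<lambda>\<omega>. \<Sum>j=1..n. w j * \<epsilon> j \<omega>)"
    unfolding weighted_sum_def using reindex[of "\<lambda>x j. x * \<epsilon> j _"] by auto
  have ind: "indep_vars (\<lambda>_. borel) (\<lambda>j \<omega>. w j * \<epsilon> j \<omega>) {1..n}"
    by (rule indep_vars_compose2[OF indep_vars_subset[OF indep]]) auto
  have "integrable M (\<lambda>\<omega>. (\<Sum>j=1..n. w j * \<epsilon> j \<omega>)\<^sup>2) \<and>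
    expectation (\<lambda>\<omega>. (\<Sum>j=1..n. w j * \<epsilon> j \<omega>)\<^sup>2) = (\<Sum>j=1..n. expectation (\<lambda>\<omega>. (w j * \<epsilon> j \<omega>)\<^sup>2))"
    using mean var by (intro second_moment_sum_indep ind) (auto simp: power_mult_distrib)
  moreover have "(\<Sum>j=1..n. expectation (\<lambda>\<omega>. (w j * \<epsilon> j \<omega>)\<^sup>2))
      = (\<Sum>i=1..n. (dz c z \<sigma> n i)\<^sup>2 * expectation (\<lambda>\<omega>. (\<epsilon> (\<sigma> n i) \<omega>)\<^sup>2))"
    using reindex[of "\<lambda>x j. x\<^sup>2 * expectation (\<lambda>\<omega>. (\<epsilon> j \<omega>)\<^sup>2)"] by (simp add: power_mult_distrib)
  moreover have "\<dots> = (noise_scale M c z \<sigma> \<epsilon> n)\<^sup>2"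
    unfolding noise_scale_def by (subst real_sqrt_pow2) (auto intro!: sum_nonneg)
  ultimately show "integrable M (\<lambda>\<omega>. (weighted_sum c z \<sigma> \<epsilon> n \<omega>)\<^sup>2)"
    and "(\<integral>\<omega>. (weighted_sum c z \<sigma> \<epsilon> n \<omega>)\<^sup>2 \<partial>M) = (noise_scale M c z \<sigma> \<epsilon> n)\<^sup>2"
    unfolding ws by auto
qed

section \<open>Weak convergence and the normal distribution\<close>

text \<open>This is the continuous mapping theorem for maps that vary with \<open>n\<close>.
  Skorohod's coupling replaces weak convergence by convergence at every point of one probability
  space, where \<open>lim\<close> applies; bounded continuous test functions then converge in mean
  by dominated convergence.\<close>

lemma weak_conv_m_extended_mapping:
  fixes \<mu> :: "nat \<Rightarrow> real measure" and \<nu> :: "real measure"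
  assumes \<mu>: "\<And>n. real_distribution (\<mu> n)" and \<nu>: "real_distribution \<nu>" and conv: "weak_conv_m \<mu> \<nu>"
    and h [measurable]: "\<And>n. h n \<in> borel_measurable borel"
    and k [measurable]: "k \<in> borel_measurable borel"
    and lim: "\<And>y y'. y' \<longlonglongrightarrow> y \<Longrightarrow> (\<lambda>n. h n (y' n)) \<longlonglongrightarrow> k y"
  shows "weak_conv_m (\<lambda>n. distr (\<mu> n) borel (h n)) (distr \<nu> borel k)"
proof -
  obtain \<Omega> :: "real measure" and Y' Y where "prob_space \<Omega>"
    and Y' [measurable]: "\<And>n. Y' n \<in> borel_measurable \<Omega>" and dY': "\<And>n. distr \<Omega> borel (Y' n) = \<mu> n"
    and Y [measurable]: "Y \<in> borel_measurable \<Omega>" and dY: "distr \<Omega> borel Y = \<nu>"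
    and YY: "\<And>x. x \<in> space \<Omega> \<Longrightarrow> (\<lambda>n. Y' n x) \<longlonglongrightarrow> Y x"
    using Skorohod[OF \<mu> \<nu> conv] by force
  interpret \<Omega>: prob_space \<Omega> by fact
  have d1: "distr (\<mu> n) borel (h n) = distr \<Omega> borel (\<lambda>x. h n (Y' n x))" for n
    by (simp add: dY'[symmetric] distr_distr comp_def)
  have d2: "distr \<nu> borel k = distr \<Omega> borel (\<lambda>x. k (Y x))"
    by (simp add: dY[symmetric] distr_distr comp_def)
  show ?thesis
    unfolding d1 d2
  proof (rule integral_bdd_continuous_conv_imp_weak_conv)
    fix f :: "real \<Rightarrow> real" assume cont: "\<And>x. isCont f x" and bdd: "\<And>x. \<bar>f x\<bar> \<le> 1"
    have [measurable]: "f \<in> borel_measurable borel"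
      using cont by (auto intro!: borel_measurable_continuous_onI continuous_at_imp_continuous_on)
    have "(\<lambda>n. \<integral>x. f (h n (Y' n x)) \<partial>\<Omega>) \<longlonglongrightarrow> (\<integral>x. f (k (Y x)) \<partial>\<Omega>)"
      using bdd by (intro integral_dominated_convergence[where w="\<lambda>_. 1"] AE_I2
          isCont_tendsto_compose[OF cont] lim YY) auto
    then show "(\<lambda>n. integral\<^sup>L (distr \<Omega> borel (\<lambda>x. h n (Y' n x))) f)
        \<longlonglongrightarrow> integral\<^sup>L (distr \<Omega> borel (\<lambda>x. k (Y x))) f"
      by (simp add: integral_distr)
  qed (auto intro!: \<Omega>.real_distribution_distr)
qed

lemma distr_std_normal_scale:
  assumes "a \<noteq> 0"
  shows "distr std_normal_distribution borel (\<lambda>x. a * x) = density lborel (normal_density 0 \<bar>a\<bar>)"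
proof -
  interpret prob_space std_normal_distribution
    by (rule prob_space_normal_density) simp
  have "distributed std_normal_distribution lborel (\<lambda>x. x) std_normal_density"
    by (simp add: distributed_def distr_id2)
  from normal_density_affine[OF this, of a 0] assms show ?thesis
    by (simp add: distributed_def cong: distr_cong)
qed

lemma std_normal_Iic_pos: "measure std_normal_distribution {..x} > 0"
proof -
  interpret prob_space std_normal_distribution
    by (rule prob_space_normal_density) simp
  \<comment> \<open>The density is positive everywhere, so a normal null set is Lebesgue null, but
    the half-line contains an interval of length 1.\<close>
  have "{..x} \<notin> null_sets std_normal_distribution"
  proof
    assume "{..x} \<in> null_sets std_normal_distribution"
    then have "AE y in lborel. y \<notin> {..x}"
      by (subst (asm) null_sets_density_iff) (auto simp: normal_density_pos less_imp_neq[symmetric])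
    then have "{..x} \<in> null_sets lborel"
      by (subst AE_iff_null_sets) auto
    then have "{x - 1..x} \<in> null_sets lborel"
      by (rule null_sets_subset) auto
    then show False
      by (auto simp: null_sets_def)
  qed
  then show ?thesis
    using emeasure_eq_measure by (auto simp: null_sets_def zero_less_measure_iff)
qed

text \<open>Division by zero yields 0, so \<open>s n = 0\<close> turns the law of the quotient into
  the point mass at 0, whose distribution function vanishes at -1. The normal one is positive there,
  so convergence at -1 excludes this for large \<open>n\<close>.\<close>

lemma weak_conv_std_normal_quotient_nonzero:
  assumes prob: "prob_space M" and [measurable]: "\<And>n. V n \<in> borel_measurable M"
    and conv: "weak_conv_m (\<lambda>n. distr M borel (\<lambda>\<omega>. V n \<omega> / s n)) std_normal_distribution"
  shows "eventually (\<lambda>n. s n \<noteq> 0) sequentially"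
proof -
  interpret prob_space M by fact
  interpret N: real_distribution std_normal_distribution
    by (simp add: real_distribution_def real_distribution_axioms_def prob_space_normal_density)
  \<comment> \<open>The limit law has no atom at -1, which makes -1 a continuity point, where the
    distribution functions must converge.\<close>
  have "AE x in lborel. x \<in> {-1::real} \<longrightarrow> ennreal (std_normal_density x) = 0"
    using AE_lborel_singleton[of "-1::real"] by eventually_elim simp
  then have "{-1} \<in> null_sets std_normal_distribution"
    by (subst null_sets_density_iff) auto
  then have "isCont (cdf std_normal_distribution) (-1)"
    by (simp add: N.isCont_cdf measure_eq_0_null_sets)
  then have "(\<lambda>n. cdf (distr M borel (\<lambda>\<omega>. V n \<omega> / s n)) (-1)) \<longlonglongrightarrow> cdf std_normal_distribution (-1)"
    using conv by (auto simp: weak_conv_m_def weak_conv_def)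
  then have "eventually (\<lambda>n. cdf (distr M borel (\<lambda>\<omega>. V n \<omega> / s n)) (-1) > 0) sequentially"
    by (rule order_tendstoD) (simp add: cdf_def std_normal_Iic_pos)
  then show ?thesis
  proof eventually_elim
    case (elim n)
    show ?case
    proof
      assume "s n = 0"
      with elim show False
        by (simp add: cdf_def measure_return)
    qed
  qed
qed

section \<open>The deterministic bias\<close>

text \<open>The nodes run from \<open>c\<close> to the largest design point, so the sum approximates
  the integral only up to there; this is why the tail is taken off the full integral.\<close>

lemma bias_le_modulus_sum:
  assumes design: "\<And>i. i \<ge> 1 \<Longrightarrow> c \<le> z i \<and> ereal (z i) \<le> d"
    and sorted: "sorts_design z \<sigma>" and g: "riemann_integrable_upto g c d"
  shows "ereal \<bar>(\<Sum>i=1..n. dz c z \<sigma> n i * g (z (\<sigma> n i)))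
      - (riemann_integral_upto g c d - riemann_integral_upto g (zord c z \<sigma> n n) d)\<bar>
    \<le> modulus_sum c d z \<sigma> g n"
proof -
  \<comment> \<open>Needed for \<open>n = 0\<close>, where the last node is \<open>c\<close>
    itself.\<close>
  have c: "ereal c \<le> d"
    using design[of 1] by (metis ereal_less_eq(3) le_refl order_trans)
  have "c \<le> zord c z \<sigma> n n \<and> ereal (zord c z \<sigma> n n) \<le> d"
  proof (cases "n = 0")
    case False
    have "\<sigma> n n \<in> {1..n}"
      using sorted False permutes_in_image[of "\<sigma> n" "{1..n}" n] by (simp add: sorts_design_def)
    then show ?thesis
      using design[of "\<sigma> n n"] False by (simp add: zord_def)
  qed (simp add: zord_def c)
  then have zn: "c \<le> zord c z \<sigma> n n" "ereal (zord c z \<sigma> n n) \<le> d"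
    by auto
  have "(\<Sum>i=1..n. dz c z \<sigma> n i * g (z (\<sigma> n i))) = (\<Sum>i=1..n. dz c z \<sigma> n i * g (zord c z \<sigma> n i))"
    by (intro sum.cong) (auto simp: zord_def)
  moreover have "zord c z \<sigma> n 0 = c"
    by (simp add: zord_def)
  ultimately show ?thesis
    using right_riemann_sum_error[of n "zord c z \<sigma> n" c d g] zord_mono[OF design sorted] zn
      riemann_integral_upto_split[OF g zn]
    by (simp add: dz_def modulus_sum_def)
qed

text \<open>The scaling \<open>k\<close> stands for \<open>\<alpha> n powr (1 / p)\<close> in the
  consistency proof and for the reciprocal of the noise scale in the proof of asymptotic
  normality.\<close>

lemma scaled_bias_tendsto_0:
  assumes design: "\<And>i. i \<ge> 1 \<Longrightarrow> c \<le> z i \<and> ereal (z i) \<le> d"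
    and sorted: "sorts_design z \<sigma>" and g: "riemann_integrable_upto g c d"
    and k: "\<And>n. 0 \<le> k n"
    and modulus: "(\<lambda>n. ereal (k n) * modulus_sum c d z \<sigma> g n) \<longlonglongrightarrow> 0"
    and tail: "(\<lambda>n. k n * riemann_integral_upto g (zord c z \<sigma> n n) d) \<longlonglongrightarrow> 0"
  shows "(\<lambda>n. k n * ((\<Sum>i=1..n. dz c z \<sigma> n i * g (z (\<sigma> n i))) - riemann_integral_upto g c d)) \<longlonglongrightarrow> 0"
proof -
  define e where "e n = (\<Sum>i=1..n. dz c z \<sigma> n i * g (z (\<sigma> n i)))
      - (riemann_integral_upto g c d - riemann_integral_upto g (zord c z \<sigma> n n) d)" for n
  have le: "ereal \<bar>k n * e n\<bar> \<le> ereal (k n) * modulus_sum c d z \<sigma> g n" for n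
  proof -
    have "ereal (k n) * ereal \<bar>e n\<bar> \<le> ereal (k n) * modulus_sum c d z \<sigma> g n"
      unfolding e_def using k by (intro ereal_mult_left_mono bias_le_modulus_sum[OF design sorted g]) auto
    then show ?thesis
      using k[of n] by (simp add: abs_mult)
  qed
  have "(\<lambda>n. ereal \<bar>k n * e n\<bar>) \<longlonglongrightarrow> 0"
    by (rule tendsto_sandwich[OF _ _ tendsto_const modulus]) (auto intro!: always_eventually le)
  then have "(\<lambda>n. \<bar>k n * e n\<bar>) \<longlonglongrightarrow> 0"
    by (simp add: zero_ereal_def)
  then have "(\<lambda>n. k n * e n) \<longlonglongrightarrow> 0"
    by (simp only: tendsto_rabs_zero_iff)
  from tendsto_diff[OF this tail] show ?thesis
    by (simp add: e_def algebra_simps)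
qed

section \<open>Local behaviour of the inverse of \<open>T\<close>\<close>

text \<open>
  On the image of \<open>T\<close> this is the Hoelder bound. Off the image, a large deviation forces
  \<open>\<alpha>\<close> itself to be bounded below, since \<open>g\<close> is bounded there, and \<open>s\<close> to be far from
  \<open>T \<theta>\<close>, since the image is open; so \<open>\<alpha>\<close> need not be bounded away from zero.
\<close>

lemma holder_inverse_deviation:
  assumes g: "inverse_extension \<Theta> T g" and "open (T ` \<Theta>)" "\<theta> \<in> \<Theta>"
    and hol: "holder_on p (T ` \<Theta>) g" and p: "0 < p" and e: "0 < e"
  obtains \<eta> where "\<eta> > 0"
    "\<And>\<alpha> s. 0 \<le> \<alpha> \<Longrightarrow> e < \<alpha> * \<bar>g s - \<theta>\<bar> \<Longrightarrow> \<eta> \<le> \<alpha> powr (1 / p) * \<bar>s - T \<theta>\<bar>"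
proof -
  have \<theta>: "g (T \<theta>) = \<theta>"
    using g assms(3) by (simp add: inverse_extension_def)
  obtain L where L: "\<And>x y. x \<in> T ` \<Theta> \<Longrightarrow> y \<in> T ` \<Theta> \<Longrightarrow> \<bar>g x - g y\<bar> \<le> L * \<bar>x - y\<bar> powr p"
    using hol by (auto simp: holder_on_def)
  \<comment> \<open>The Hoelder constant \<open>L\<close> may be zero or negative; \<open>K\<close>
    is positive and can be divided by. The summand 1 in \<open>B\<close> below serves the same
    purpose.\<close>
  define K where "K = max L 1"
  have K0: "K > 0"
    by (simp add: K_def)
  have K: "\<bar>g s - \<theta>\<bar> \<le> K * \<bar>s - T \<theta>\<bar> powr p" if "s \<in> T ` \<Theta>" for s
  proof -
    have "L * \<bar>s - T \<theta>\<bar> powr p \<le> K * \<bar>s - T \<theta>\<bar> powr p"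
      by (intro mult_right_mono) (auto simp: K_def)
    then show ?thesis
      using L[of s "T \<theta>"] that assms(3) \<theta> by auto
  qed
  obtain \<rho> where \<rho>: "\<rho> > 0" "ball (T \<theta>) \<rho> \<subseteq> T ` \<Theta>"
    using assms(2,3) by (metis image_eqI openE)
  obtain b where b: "\<And>s. s \<notin> T ` \<Theta> \<Longrightarrow> \<bar>g s\<bar> \<le> b"
    using g unfolding inverse_extension_def bounded_iff by (metis ComplI imageI real_norm_def)
  define B where "B = \<bar>b\<bar> + \<bar>\<theta>\<bar> + 1"
  have B0: "B > 0"
    by (simp add: B_def)
  have B: "\<bar>g s - \<theta>\<bar> \<le> B" if "s \<notin> T ` \<Theta>" for s
    using b[OF that] by (simp add: B_def)
  show thesis
  proof
    \<comment> \<open>The first entry is the bound obtained on the image of \<open>T\<close>, the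
      second the one obtained off it.\<close>
    show "min ((e / K) powr (1 / p)) ((e / B) powr (1 / p) * \<rho>) > 0"
      using e K0 B0 \<rho> by simp
  next
    fix \<alpha> s :: real assume \<alpha>: "0 \<le> \<alpha>" and dev: "e < \<alpha> * \<bar>g s - \<theta>\<bar>"
    show "min ((e / K) powr (1 / p)) ((e / B) powr (1 / p) * \<rho>) \<le> \<alpha> powr (1 / p) * \<bar>s - T \<theta>\<bar>"
    proof (cases "s \<in> T ` \<Theta>")
      case True
      have "e \<le> \<alpha> * (K * \<bar>s - T \<theta>\<bar> powr p)"
        using dev mult_left_mono[OF K[OF True] \<alpha>] by simp
      then have "e / K \<le> \<alpha> * \<bar>s - T \<theta>\<bar> powr p"
        using K0 by (simp add: field_simps)
      \<comment> \<open>Taking the power \<open>1 / p\<close> undoes the Hoelder exponent and is the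
        origin of the rate \<open>\<alpha> powr (1 / p)\<close>.\<close>
      then have "(e / K) powr (1 / p) \<le> (\<alpha> * \<bar>s - T \<theta>\<bar> powr p) powr (1 / p)"
        using e K0 p by (intro powr_mono2) auto
      also have "\<dots> = \<alpha> powr (1 / p) * \<bar>s - T \<theta>\<bar>"
        using \<alpha> p by (simp add: powr_mult powr_powr)
      finally show ?thesis by simp
    next
      case False
      then have \<rho>s: "\<rho> \<le> \<bar>s - T \<theta>\<bar>"
        using \<rho>(2) by (force simp: dist_real_def)
      have "e \<le> \<alpha> * B"
        using dev mult_left_mono[OF B[OF False] \<alpha>] by simp
      then have "e / B \<le> \<alpha>"
        using B0 by (simp add: field_simps)
      then have "(e / B) powr (1 / p) \<le> \<alpha> powr (1 / p)"
        using e B0 p by (intro powr_mono2) auto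
      then have "(e / B) powr (1 / p) * \<rho> \<le> \<alpha> powr (1 / p) * \<bar>s - T \<theta>\<bar>"
        using \<rho>s \<rho>(1) by (intro mult_mono) auto
      then show ?thesis by simp
    qed
  qed
qed

text \<open>Caratheodory's form of the derivative writes the increment of \<open>g\<close> as a
  factor continuous at \<open>x\<close> times the increment of the argument. Dividing by
  \<open>s n\<close> then needs no case distinction on whether \<open>w n\<close> is zero.\<close>

lemma difference_quotient_tendsto:
  fixes g :: "real \<Rightarrow> real"
  assumes g: "(g has_real_derivative D) (at x)"
    and s: "s \<longlonglongrightarrow> 0" "eventually (\<lambda>n. s n \<noteq> 0) sequentially" and w: "w \<longlonglongrightarrow> y"
  shows "(\<lambda>n. (g (x + s n * w n) - g x) / s n) \<longlonglongrightarrow> D * y"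
proof -
  obtain h where h: "\<And>z. g z - g x = h z * (z - x)" "isCont h x" "h x = D"
    using g unfolding CARAT_DERIV by blast
  have "(\<lambda>n. x + s n * w n) \<longlonglongrightarrow> x + 0 * y"
    by (intro tendsto_intros s w)
  then have "(\<lambda>n. h (x + s n * w n) * w n) \<longlonglongrightarrow> D * y"
    using h by (intro tendsto_mult w) (auto intro: isCont_tendsto_compose)
  moreover have "eventually (\<lambda>n. h (x + s n * w n) * w n = (g (x + s n * w n) - g x) / s n) sequentially"
    using s(2) by eventually_elim (simp add: h(1))
  ultimately show ?thesis
    by (rule Lim_transform_eventually)
qed

section \<open>The two limit theorems for the estimator\<close>

theorem mainTheorem7:
  fixes M :: "'w measure"
    and f :: "real \<Rightarrow> real \<Rightarrow> real" and z :: "nat \<Rightarrow> real"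
    and \<epsilon> X :: "nat \<Rightarrow> 'w \<Rightarrow> real" and \<sigma> :: "nat \<Rightarrow> nat \<Rightarrow> nat"
    and a b d :: ereal and c \<theta> p :: real and T Tinv :: "real \<Rightarrow> real"
  assumes prob: "prob_space M"
    and indep: "prob_space.indep_vars M (\<lambda>_. borel) \<epsilon> {1..}"
    and mean: "\<And>i. i \<ge> 1 \<Longrightarrow> integrable M (\<epsilon> i) \<and> (\<integral>\<omega>. \<epsilon> i \<omega> \<partial>M) = 0"
    and var: "\<And>i. i \<ge> 1 \<Longrightarrow> integrable M (\<lambda>\<omega>. (\<epsilon> i \<omega>)\<^sup>2)"
    and theta: "\<theta> \<in> einterval a b"
    and model: "\<And>i \<omega>. i \<ge> 1 \<Longrightarrow> \<omega> \<in> space M \<Longrightarrow> X i \<omega> = f \<theta> (z i) + \<epsilon> i \<omega>"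
    and design: "\<And>i. i \<ge> 1 \<Longrightarrow> c \<le> z i \<and> ereal (z i) \<le> d"
    and sorted: "sorts_design z \<sigma>"
    and z_max: "(\<lambda>n. ereal (zord c z \<sigma> n n)) \<longlonglongrightarrow> d"
    and mesh: "(\<lambda>n. Max ((\<lambda>i. dz c z \<sigma> n i) ` {1..n})) \<longlonglongrightarrow> 0"
    and f_int: "\<And>t. t \<in> einterval a b \<Longrightarrow> riemann_integrable_upto (f t) c d"
    and T_def: "\<And>t. t \<in> einterval a b \<Longrightarrow> T t = riemann_integral_upto (f t) c d"
    and T_mono: "strict_mono_on (einterval a b) T \<or> strict_antimono_on (einterval a b) T"
    and T_cont: "continuous_on (einterval a b) T"
    and Tinv: "inverse_extension (einterval a b) T Tinv"
    and p: "0 < p" "p \<le> 1"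
    and holder: "holder_on p (T ` einterval a b) Tinv"
  shows "(\<forall>\<alpha> :: nat \<Rightarrow> real.
            (\<forall>n. 0 \<le> \<alpha> n) \<and>
            (\<lambda>n. \<alpha> n powr (1 / p) * noise_scale M c z \<sigma> \<epsilon> n) \<longlonglongrightarrow> 0 \<and>
            (\<lambda>n. ereal (\<alpha> n powr (1 / p)) * modulus_sum c d z \<sigma> (f \<theta>) n) \<longlonglongrightarrow> 0 \<and>
            (\<lambda>n. \<alpha> n powr (1 / p) * riemann_integral_upto (f \<theta>) (zord c z \<sigma> n n) d) \<longlonglongrightarrow> 0
            \<longrightarrow> tendsto_in_prob M (\<lambda>n \<omega>. \<alpha> n * (theta_est Tinv c z \<sigma> X n \<omega> - \<theta>)) 0)
       \<and> (T C1_differentiable_on einterval a b \<and>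
          deriv T \<theta> \<noteq> 0 \<and>
          (\<lambda>n. ereal (1 / noise_scale M c z \<sigma> \<epsilon> n) * modulus_sum c d z \<sigma> (f \<theta>) n) \<longlonglongrightarrow> 0 \<and>
          (\<lambda>n. 1 / noise_scale M c z \<sigma> \<epsilon> n
                * riemann_integral_upto (f \<theta>) (zord c z \<sigma> n n) d) \<longlonglongrightarrow> 0 \<and>
          noise_scale M c z \<sigma> \<epsilon> \<longlonglongrightarrow> 0 \<and>
          weak_conv_m
            (\<lambda>n. distr M borel (\<lambda>\<omega>. weighted_sum c z \<sigma> \<epsilon> n \<omega> / noise_scale M c z \<sigma> \<epsilon> n))
            std_normal_distribution
          \<longrightarrow> weak_conv_m
            (\<lambda>n. distr M borel (\<lambda>\<omega>. (theta_est Tinv c z \<sigma> X n \<omega> - \<theta>) / noise_scale M c z \<sigma> \<epsilon> n))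
            (density lborel (normal_density 0 (1 / \<bar>deriv T \<theta>\<bar>))))"
proof -
  interpret prob_space M by (rule prob)
  let ?\<Theta> = "einterval a b"
  define N where "N = weighted_sum c z \<sigma> \<epsilon>"
  define s where "s = noise_scale M c z \<sigma> \<epsilon>"
  define r where "r n = (\<Sum>i=1..n. dz c z \<sigma> n i * f \<theta> (z (\<sigma> n i))) - riemann_integral_upto (f \<theta>) c d" for n
  have \<sigma>: "\<sigma> n i \<ge> 1" if "i \<in> {1..n}" for n i
    using sorted that permutes_in_image[of "\<sigma> n" "{1..n}" i] by (simp add: sorts_design_def)
  have eps [measurable]: "\<epsilon> i \<in> borel_measurable M" if "i \<ge> 1" for i
    using mean[OF that] by auto
  have N_meas [measurable]: "N n \<in> borel_measurable M" for n
    unfolding N_def weighted_sum_def using \<sigma> by (intro borel_measurable_sum borel_measurable_times eps) auto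
  have N2: "integrable M (\<lambda>\<omega>. (N n \<omega>)\<^sup>2)" "expectation (\<lambda>\<omega>. (N n \<omega>)\<^sup>2) = (s n)\<^sup>2" for n
    using weighted_sum_indep_second_moment[OF prob indep mean var sorted] by (auto simp: N_def s_def)
  have est: "theta_est Tinv c z \<sigma> X n \<omega> = Tinv (T \<theta> + (N n \<omega> + r n))" if "\<omega> \<in> space M" for n \<omega>
  proof -
    have "weighted_sum c z \<sigma> X n \<omega> = (\<Sum>i=1..n. dz c z \<sigma> n i * (f \<theta> (z (\<sigma> n i)) + \<epsilon> (\<sigma> n i) \<omega>))"
      unfolding weighted_sum_def using model[OF \<sigma> that] by (intro sum.cong) auto
    also have "\<dots> = T \<theta> + (N n \<omega> + r n)"
      by (simp add: N_def weighted_sum_def r_def T_def[OF theta] distrib_left sum.distrib)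
    finally show ?thesis
      by (simp add: theta_est_def)
  qed
  have inv: "Tinv (T t) = t" if "t \<in> ?\<Theta>" for t
    using Tinv that by (simp add: inverse_extension_def)
  have inj: "inj_on T ?\<Theta>"
    by (rule inj_on_inverseI[of _ Tinv]) (rule inv)
  have open_img: "open (T ` ?\<Theta>)"
    using injective_into_1d_imp_open_map_UNIV[OF open_einterval T_cont inj] by simp
  note bias = scaled_bias_tendsto_0[OF design sorted f_int[OF theta], folded r_def]
  show ?thesis
  proof (intro conjI allI impI)

    \<comment> \<open>Consistency\<close>
    fix \<alpha> :: "nat \<Rightarrow> real"
    assume A: "(\<forall>n. 0 \<le> \<alpha> n) \<and>
      (\<lambda>n. \<alpha> n powr (1 / p) * noise_scale M c z \<sigma> \<epsilon> n) \<longlonglongrightarrow> 0 \<and>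
      (\<lambda>n. ereal (\<alpha> n powr (1 / p)) * modulus_sum c d z \<sigma> (f \<theta>) n) \<longlonglongrightarrow> 0 \<and>
      (\<lambda>n. \<alpha> n powr (1 / p) * riemann_integral_upto (f \<theta>) (zord c z \<sigma> n n) d) \<longlonglongrightarrow> 0"
    define k where "k n = \<alpha> n powr (1 / p)" for n
    have k0: "0 \<le> k n" for n
      by (simp add: k_def)
    have ks: "(\<lambda>n. k n * s n) \<longlonglongrightarrow> 0"
      using A by (simp add: k_def s_def)
    have kr: "(\<lambda>n. k n * r n) \<longlonglongrightarrow> 0"
      using A by (intro bias) (auto simp: k_def)
    show "tendsto_in_prob M (\<lambda>n \<omega>. \<alpha> n * (theta_est Tinv c z \<sigma> X n \<omega> - \<theta>)) 0"
      unfolding tendsto_in_prob_def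
    proof (intro allI impI)
      fix e :: real assume "e > 0"
      obtain \<eta> where \<eta>: "\<eta> > 0"
        "\<And>\<alpha> s. 0 \<le> \<alpha> \<Longrightarrow> e < \<alpha> * \<bar>Tinv s - \<theta>\<bar> \<Longrightarrow> \<eta> \<le> \<alpha> powr (1 / p) * \<bar>s - T \<theta>\<bar>"
        using holder_inverse_deviation[OF Tinv open_img theta holder p(1) \<open>e > 0\<close>] by metis
      \<comment> \<open>Half of the threshold is spent on the bias, so a large deviation of the
        estimator forces the scaled noise to reach the other half, which Chebyshev's inequality
        bounds.\<close>
      have "eventually (\<lambda>n. \<bar>k n * r n\<bar> < \<eta> / 2) sequentially"
        using tendsto_rabs_zero[OF kr] \<eta>(1) by (intro order_tendstoD) auto
      then have bound: "eventually (\<lambda>n. prob {\<omega> \<in> space M. \<bar>\<alpha> n * (theta_est Tinv c z \<sigma> X n \<omega> - \<theta>) - 0\<bar> > e}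
          \<le> (k n * s n)\<^sup>2 / (\<eta> / 2)\<^sup>2) sequentially"
      proof eventually_elim
        case (elim n)
        have "prob {\<omega> \<in> space M. \<bar>\<alpha> n * (theta_est Tinv c z \<sigma> X n \<omega> - \<theta>) - 0\<bar> > e}
            \<le> prob {\<omega> \<in> space M. \<bar>k n * N n \<omega>\<bar> \<ge> \<eta> / 2}"
        proof (rule finite_measure_mono)
          show "{\<omega> \<in> space M. \<bar>\<alpha> n * (theta_est Tinv c z \<sigma> X n \<omega> - \<theta>) - 0\<bar> > e}
              \<subseteq> {\<omega> \<in> space M. \<bar>k n * N n \<omega>\<bar> \<ge> \<eta> / 2}"
          proof safe
            fix \<omega> assume \<omega>: "\<omega> \<in> space M" and "\<bar>\<alpha> n * (theta_est Tinv c z \<sigma> X n \<omega> - \<theta>) - 0\<bar> > e"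
            then have "\<eta> \<le> k n * \<bar>N n \<omega> + r n\<bar>"
              using \<eta>(2)[of "\<alpha> n" "T \<theta> + (N n \<omega> + r n)"] A est[OF \<omega>, of n] by (simp add: abs_mult k_def)
            also have "\<dots> = \<bar>k n * N n \<omega> + k n * r n\<bar>"
              using k0[of n] by (simp add: abs_mult flip: distrib_left)
            finally show "\<eta> / 2 \<le> \<bar>k n * N n \<omega>\<bar>"
              using elim by linarith
          qed
        qed measurable
        also have "\<dots> \<le> expectation (\<lambda>\<omega>. (k n * N n \<omega>)\<^sup>2) / (\<eta> / 2)\<^sup>2"
          using \<eta>(1) N2 by (intro second_moment_method) (auto simp: power_mult_distrib)
        also have "\<dots> = (k n * s n)\<^sup>2 / (\<eta> / 2)\<^sup>2"
          by (simp add: power_mult_distrib N2)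
        finally show ?case .
      qed
      have "(\<lambda>n. (k n * s n)\<^sup>2 / (\<eta> / 2)\<^sup>2) \<longlonglongrightarrow> 0\<^sup>2 / (\<eta> / 2)\<^sup>2"
        using \<eta>(1) by (intro tendsto_divide tendsto_power tendsto_const ks) auto
      then have lim: "(\<lambda>n. (k n * s n)\<^sup>2 / (\<eta> / 2)\<^sup>2) \<longlonglongrightarrow> 0"
        by simp
      show "(\<lambda>n. prob {\<omega> \<in> space M. \<bar>\<alpha> n * (theta_est Tinv c z \<sigma> X n \<omega> - \<theta>) - 0\<bar> > e}) \<longlonglongrightarrow> 0"
        by (rule tendsto_sandwich[OF _ bound tendsto_const lim]) simp
    qed
  next

    \<comment> \<open>Asymptotic normality\<close>
    assume A: "T C1_differentiable_on ?\<Theta> \<and> deriv T \<theta> \<noteq> 0 \<and>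
      (\<lambda>n. ereal (1 / noise_scale M c z \<sigma> \<epsilon> n) * modulus_sum c d z \<sigma> (f \<theta>) n) \<longlonglongrightarrow> 0 \<and>
      (\<lambda>n. 1 / noise_scale M c z \<sigma> \<epsilon> n * riemann_integral_upto (f \<theta>) (zord c z \<sigma> n n) d) \<longlonglongrightarrow> 0 \<and>
      noise_scale M c z \<sigma> \<epsilon> \<longlonglongrightarrow> 0 \<and>
      weak_conv_m (\<lambda>n. distr M borel (\<lambda>\<omega>. weighted_sum c z \<sigma> \<epsilon> n \<omega> / noise_scale M c z \<sigma> \<epsilon> n))
        std_normal_distribution"
    let ?D = "deriv T \<theta>"
    define \<rho> where "\<rho> n = 1 / s n * r n" for n
    \<comment> \<open>The bias is absorbed into \<open>h n\<close>, so no Slutsky argument is needed. If \<open>s n = 0\<close>, both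
      \<open>h n\<close> and the normalized error are 0 because of division by zero.\<close>
    define h where "h n y = (Tinv (T \<theta> + s n * (y + \<rho> n)) - \<theta>) / s n" for n y
    have D0: "?D \<noteq> 0" and s0: "s \<longlonglongrightarrow> 0"
      and conv: "weak_conv_m (\<lambda>n. distr M borel (\<lambda>\<omega>. N n \<omega> / s n)) std_normal_distribution"
      using A by (auto simp: s_def N_def)
    have s_nonneg: "0 \<le> s n" for n
      unfolding s_def noise_scale_def by (auto intro!: sum_nonneg)
    have \<rho>0: "\<rho> \<longlonglongrightarrow> 0"
      unfolding \<rho>_def using A s_nonneg by (intro bias) (auto simp: s_def)
    have s_ev: "eventually (\<lambda>n. s n \<noteq> 0) sequentially"
      by (rule weak_conv_std_normal_quotient_nonzero[OF prob N_meas conv])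
    have "(T has_real_derivative ?D) (at \<theta>)"
      using A theta unfolding C1_differentiable_on_def
      by (metis DERIV_imp_deriv has_real_derivative_iff_has_vector_derivative)
    \<comment> \<open>The inverse function theorem is applied with \<open>Tinv\<close> as left
      inverse on the open interval; since \<open>?D\<close> is nonzero, multiplication by
      \<open>1 / ?D\<close> inverts the derivative of \<open>T\<close>.\<close>
    then have "(Tinv has_derivative (\<lambda>x. (1 / ?D) * x)) (at (T \<theta>))"
      using D0 by (intro has_derivative_inverse_strong[OF open_einterval theta T_cont inv])
        (auto simp: has_field_derivative_def fun_eq_iff)
    then have Tinv': "(Tinv has_real_derivative 1 / ?D) (at (T \<theta>))"
      by (simp only: has_field_derivative_def)
    \<comment> \<open>As \<open>Tinv (T \<theta>)\<close> is \<open>\<theta>\<close>, the map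
      \<open>h n\<close> is a difference quotient of \<open>Tinv\<close> at
      \<open>T \<theta>\<close>, and the shift by \<open>\<rho> n\<close> disappears in the
      limit.\<close>
    have h_lim: "(\<lambda>n. h n (y' n)) \<longlonglongrightarrow> 1 / ?D * y" if "y' \<longlonglongrightarrow> y" for y' y
      using difference_quotient_tendsto[OF Tinv' s0 s_ev, of "\<lambda>n. y' n + \<rho> n" y] tendsto_add[OF that \<rho>0] inv[OF theta]
      by (simp add: h_def)
    have [measurable]: "Tinv \<in> borel_measurable borel"
      using Tinv by (simp add: inverse_extension_def)
    have h_meas [measurable]: "h n \<in> borel_measurable borel" for n
      unfolding h_def by measurable
    have "real_distribution std_normal_distribution"
      by (simp add: real_distribution_def real_distribution_axioms_def prob_space_normal_density)
    then have "weak_conv_m (\<lambda>n. distr (distr M borel (\<lambda>\<omega>. N n \<omega> / s n)) borel (h n))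
        (distr std_normal_distribution borel (\<lambda>y. 1 / ?D * y))"
      by (intro weak_conv_m_extended_mapping conv h_lim real_distribution_distr) measurable
    moreover have "distr (distr M borel (\<lambda>\<omega>. N n \<omega> / s n)) borel (h n)
        = distr M borel (\<lambda>\<omega>. (theta_est Tinv c z \<sigma> X n \<omega> - \<theta>) / s n)" for n
    proof -
      have "h n (N n \<omega> / s n) = (theta_est Tinv c z \<sigma> X n \<omega> - \<theta>) / s n" if "\<omega> \<in> space M" for \<omega>
        by (cases "s n = 0") (auto simp: h_def \<rho>_def est[OF that] distrib_left)
      then show ?thesis
        by (subst distr_distr) (auto intro!: distr_cong)
    qed
    \<comment> \<open>\<open>normal_density\<close> takes the standard deviation, so the absolute
      value covers decreasing \<open>T\<close>, and the variance is the inverse square of the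
      derivative.\<close>
    moreover have "distr std_normal_distribution borel (\<lambda>y. 1 / ?D * y)
        = density lborel (normal_density 0 (1 / \<bar>?D\<bar>))"
      using distr_std_normal_scale[of "1 / ?D"] D0 by simp
    ultimately show "weak_conv_m
        (\<lambda>n. distr M borel (\<lambda>\<omega>. (theta_est Tinv c z \<sigma> X n \<omega> - \<theta>) / noise_scale M c z \<sigma> \<epsilon> n))
        (density lborel (normal_density 0 (1 / \<bar>deriv T \<theta>\<bar>)))"
      by (simp add: s_def)
  qed
qed

end
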